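(* Let $X$ be a Hausdorff topological space, $\kappa$ an infinite cardinal and $\lambda$ an ordinal. Suppose $X=\bigcup_{\alpha<\lambda} X_\alpha$, where $X_\alpha \subseteq X_\beta$ whenever $\alpha<\beta<\lambda$, and $t(X_\alpha)\cdot\psi(X_\alpha)\cdot L(X_\alpha)\le\kappa$ for every $\alpha<\lambda$ (each $X_\alpha$ carrying the subspace topology). Then $|X|\le 2^\kappa$. *)

theory Defs
  imports "HOL-Analysis.Analysis"
begin

definition tightness_le :: "'a topology \<Rightarrow> 'k set \<Rightarrow> bool" where
  "tightness_le Y K \<longleftrightarrow>
     (\<forall>A y. A \<subseteq> topspace Y \<and> y \<in> Y closure_of A \<longrightarrow>
        (\<exists>B. B \<subseteq> A \<and> ordLeq3 (card_of B) (card_of K) \<and> y \<in> Y closure_of B))"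

definition pseudochar_le :: "'a topology \<Rightarrow> 'k set \<Rightarrow> bool" where
  "pseudochar_le Y K \<longleftrightarrow>
     (\<forall>y \<in> topspace Y. \<exists>\<U>. (\<forall>U \<in> \<U>. openin Y U) \<and> ordLeq3 (card_of \<U>) (card_of K)
        \<and> topspace Y \<inter> \<Inter>\<U> = {y})"

definition lindelof_le :: "'a topology \<Rightarrow> 'k set \<Rightarrow> bool" where
  "lindelof_le Y K \<longleftrightarrow>
     (\<forall>\<U>. (\<forall>U \<in> \<U>. openin Y U) \<and> topspace Y \<subseteq> \<Union>\<U> \<longrightarrow>
        (\<exists>\<V> \<subseteq> \<U>. ordLeq3 (card_of \<V>) (card_of K) \<and> topspace Y \<subseteq> \<Union>\<V>))"

end

theory Submission
  imports Defs
begin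

text \<open>Write \<open>\<kappa> = |K|\<close>.  Suppose first that every subset of \<open>X\<close> of size at most \<open>2\<^sup>\<kappa>\<close> lies in one of
  the pieces.  Then closures of sets of size at most \<open>\<kappa>\<close> have size at most \<open>2\<^sup>\<kappa>\<close>, and a set \<open>H\<close> of
  size at most \<open>2\<^sup>\<kappa>\<close> containing the closures of its subsets of size at most \<open>\<kappa>\<close> is closed in \<open>X\<close>,
  because \<open>H\<close> and any further point lie in a common piece, which has tightness at most \<open>\<kappa>\<close>.
  Being closed in a piece, \<open>H\<close> also inherits its Lindelof degree.  A closing-off argument with
  such an \<open>H\<close> shows that \<open>X\<close> has pseudocharacter at most \<open>\<kappa>\<close>, and a second one yields an \<open>H\<close>
  that is all of \<open>X\<close>.  A single piece satisfies the supposition trivially, so every piece has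
  size at most \<open>2\<^sup>\<kappa>\<close>.  If the chain violates it, then at most \<open>2\<^sup>\<kappa>\<close> of the pieces already
  cover \<open>X\<close>.\<close>

unbundle cardinal_syntax

section \<open>Cardinal arithmetic at 2^\<kappa> and closing off\<close>

lemma card_of_Un_ordLeq_Pow:
  assumes "infinite K" "|A| \<le>o |Pow K|" "|B| \<le>o |Pow K|"
  shows "|A \<union> B| \<le>o |Pow K|"
  using assms card_of_Un_ordLeq_infinite_Field[OF _ _ _ card_of_Card_order, of "Pow K" A B]
  by (simp add: Field_card_of)

lemma finite_ordLeq_infinite: "finite A \<Longrightarrow> infinite B \<Longrightarrow> |A| \<le>o |B|"
  by (metis card_of_Well_order Field_card_of finite_ordLess_infinite ordLess_imp_ordLeq)

lemma card_of_Pow_mono: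
  assumes "|A| \<le>o |B|"
  shows "|Pow A| \<le>o |Pow B|"
proof -
  obtain f where f: "inj_on f A" "f ` A \<subseteq> B"
    using assms card_of_ordLeq[of A B] by blast
  have "inj_on ((`) f) (Pow A)" "(`) f ` Pow A \<subseteq> Pow B"
    using f by (auto intro: inj_on_image_Pow)
  then show ?thesis
    using card_of_ordLeq[of "Pow A" "Pow B"] by blast
qed

text \<open>A nonempty subset of size at most \<open>|K|\<close> of \<open>T \<subseteq> Pow K\<close> is coded by a relation on \<open>K\<close>.\<close>

lemma card_of_small_subsets:
  fixes T :: "'a set" and K :: "'k set"
  assumes "infinite K" "|T| \<le>o |Pow K|"
  shows "|{W. W \<subseteq> T \<and> |W| \<le>o |K|}| \<le>o |Pow K|"
proof -
  obtain e where e: "inj_on e T" "e ` T \<subseteq> Pow K"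
    using assms(2) card_of_ordLeq[of T "Pow K"] by blast
  define \<psi> where "\<psi> R = {t \<in> T. \<exists>k\<in>K. e t = R `` {k}}" for R :: "('k \<times> 'k) set"
  have "W \<in> \<psi> ` Pow (K \<times> K)" if W: "W \<subseteq> T" "|W| \<le>o |K|" "W \<noteq> {}" for W
  proof -
    obtain f where f: "f ` K = W"
      using W card_of_ordLeq2[of W K] by blast
    define R where "R = {(k, l). k \<in> K \<and> l \<in> e (f k)}"
    have R: "R `` {k} = e (f k)" if "k \<in> K" for k
      using that by (auto simp: R_def)
    have "R \<subseteq> K \<times> K"
      using e f W by (auto simp: R_def)
    moreover have "\<psi> R = W"
    proof -
      have "f k \<in> T" if "k \<in> K" for k
        using that f W(1) by blast
      then have "e t = R `` {k} \<longleftrightarrow> t = f k" if "t \<in> T" "k \<in> K" for t k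
        using that R inj_on_eq_iff[OF e(1)] by simp
      then have "\<psi> R = {t \<in> T. \<exists>k\<in>K. t = f k}"
        unfolding \<psi>_def by blast
      then show ?thesis
        using f W(1) by blast
    qed
    ultimately show ?thesis
      by blast
  qed
  \<comment> \<open>The empty set is listed separately because a surjection from \<open>K\<close>
    onto \<open>W\<close> exists only for nonempty \<open>W\<close>.\<close>
  then have "{W. W \<subseteq> T \<and> |W| \<le>o |K|} \<subseteq> {{}} \<union> \<psi> ` Pow (K \<times> K)"
    by blast
  moreover have "|{{}} \<union> \<psi> ` Pow (K \<times> K)| \<le>o |Pow K|"
  proof (rule card_of_Un_ordLeq_Pow)
    have "|K \<times> K| \<le>o |K|"
      using card_of_Times_same_infinite[OF assms(1)] ordIso_iff_ordLeq by blast
    then have "|Pow (K \<times> K)| \<le>o |Pow K|"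
      by (rule card_of_Pow_mono)
    then show "|\<psi> ` Pow (K \<times> K)| \<le>o |Pow K|"
      using card_of_image ordLeq_transitive by blast
  qed (use assms(1) in \<open>auto intro!: finite_ordLeq_infinite\<close>)
  ultimately show ?thesis
    by (rule ordLeq_transitive[OF card_of_mono1])
qed

text \<open>Iterate \<open>F\<close> along the successor cardinal of \<open>|K|\<close>: by regularity every small
  subset of the union already appears at some stage.\<close>

lemma closing_off:
  fixes F :: "'a set \<Rightarrow> 'a set" and K :: "'k set"
  assumes inf: "infinite K"
    and F: "\<And>A. A \<subseteq> T \<Longrightarrow> |A| \<le>o |K| \<Longrightarrow> F A \<subseteq> T \<and> |F A| \<le>o |Pow K|"
    and S: "S \<subseteq> T" "|S| \<le>o |Pow K|"
  obtains H where "S \<subseteq> H" "H \<subseteq> T" "|H| \<le>o |Pow K|"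
    "\<And>A. A \<subseteq> H \<Longrightarrow> |A| \<le>o |K| \<Longrightarrow> F A \<subseteq> H"
proof -
  \<comment> \<open>As the least cardinal above \<kappa>, this one is at most 2^\<kappa>, so the
    union over all stages stays small.\<close>
  define r where "r = cardSuc |K|"
  have Kc: "Card_order |K|"
    by (rule card_of_Card_order)
  have rc: "Card_order r"
    unfolding r_def by (rule cardSuc_Card_order[OF Kc])
  have infr: "infinite (Field r)"
    unfolding r_def using cardSuc_finite[OF Kc] inf by (simp add: Field_card_of)
  interpret r: wo_rel r
    using rc by (simp add: card_order_on_well_order_on wo_rel_def)
  have infP: "infinite (Pow K)"
    using inf by simp
  have Field_le: "|Field r| \<le>o |Pow K|"
  proof -
    have "r \<le>o |Pow K|"
      unfolding r_def by (rule cardSuc_least) (auto simp: card_of_Pow card_of_Card_order)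
    then show ?thesis
      using card_of_Field_ordIso[OF rc] ordIso_ordLeq_trans by blast
  qed
  \<comment> \<open>Including \<open>S\<close> in every step spares a base case: the first stage
    starts from the empty union and already contains \<open>S\<close>.\<close>
  define step where "step U = S \<union> (\<Union>A \<in> {A. A \<subseteq> U \<and> |A| \<le>o |K|}. F A)" for U
  have step_mono: "step U \<subseteq> step V" if "U \<subseteq> V" for U V
    unfolding step_def using that by blast
  define G where "G = r.worec (\<lambda>g i. step (\<Union>j \<in> underS r i. g j))"
  have G: "G i = step (\<Union>j \<in> underS r i. G j)" for i
  proof -
    have "r.adm_wo (\<lambda>g i. step (\<Union>j \<in> underS r i. g j))"
      unfolding r.adm_wo_def by simp
    then have "G = (\<lambda>i. step (\<Union>j \<in> underS r i. G j))"
      unfolding G_def by (rule r.worec_fixpoint)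
    then show ?thesis
      by (rule fun_cong)
  qed
  have G_le: "G i \<subseteq> T \<and> |G i| \<le>o |Pow K|" for i
  proof (induction i rule: r.well_order_induct)
    case (1 i)
    define U where "U = (\<Union>j \<in> underS r i. G j)"
    have IH: "G j \<subseteq> T \<and> |G j| \<le>o |Pow K|" if "j \<in> underS r i" for j
      using 1 that unfolding underS_def by blast
    have "|underS r i| \<le>o |Pow K|"
      using card_of_mono1[OF subsetI[OF underS_Field]] Field_le by (rule ordLeq_transitive)
    then have U: "U \<subseteq> T" "|U| \<le>o |Pow K|"
      unfolding U_def using IH infP by (auto intro!: card_of_UNION_ordLeq_infinite)
    have "|step U| \<le>o |Pow K|"
      unfolding step_def
    proof (rule card_of_Un_ordLeq_Pow[OF inf S(2)], rule card_of_UNION_ordLeq_infinite[OF infP])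
      show "|{A. A \<subseteq> U \<and> |A| \<le>o |K|}| \<le>o |Pow K|"
        by (rule card_of_small_subsets[OF inf U(2)])
      show "\<forall>A\<in>{A. A \<subseteq> U \<and> |A| \<le>o |K|}. |F A| \<le>o |Pow K|"
        using F U(1) by blast
    qed
    moreover have "step U \<subseteq> T"
      unfolding step_def using S(1) F U(1) by blast
    ultimately show ?case
      using G[of i] U_def by simp
  qed
  define H where "H = (\<Union>i \<in> Field r. G i)"
  show thesis
  proof
    obtain i where "i \<in> Field r"
      using infr by fastforce
    then show "S \<subseteq> H"
      using G[of i] by (auto simp: H_def step_def)
    show "H \<subseteq> T"
      using G_le by (auto simp: H_def)
    show "|H| \<le>o |Pow K|"
      unfolding H_def using Field_le G_le infP by (auto intro!: card_of_UNION_ordLeq_infinite)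
  next
    fix A assume A: "A \<subseteq> H" "|A| \<le>o |K|"
    have "relChain r G"
      unfolding relChain_def
    proof (intro allI impI)
      fix i j assume "(i, j) \<in> r"
      then have "underS r i \<subseteq> underS r j"
        by (rule underS_incr[OF r.TRANS r.ANTISYM])
      then show "G i \<subseteq> G j"
        unfolding G[of i] G[of j] by (intro step_mono) auto
    qed
    then obtain i where i: "i \<in> Field r" "A \<subseteq> G i"
      using cardSuc_UNION[OF Kc, of G A] A inf unfolding r_def H_def
      by (auto simp: Field_card_of)
    \<comment> \<open>Since \<open>A\<close> lies in stage \<open>i\<close>, any strictly later
      stage contains \<open>F A\<close>; one exists because an infinite cardinal has no last
      element.\<close>
    obtain j where "j \<in> Field r" "i \<in> underS r j"
      using infinite_Card_order_limit[OF rc infr i(1)] by (auto simp: underS_def)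
    then have "F A \<subseteq> G j"
      unfolding G[of j] step_def using i(2) A(2) by blast
    then show "F A \<subseteq> H"
      using \<open>j \<in> Field r\<close> by (auto simp: H_def)
  qed
qed

section \<open>Covers of a Lindelof-type space with one point removed\<close>

text \<open>By the pseudocharacter, the rest of the space is a union of at most \<kappa> closed
  sets, the complements of the members \<open>U\<close> of \<open>\<U>\<close>. For each of them
  \<open>insert U \<G>\<close> covers the whole space and has a small subcover; the members of
  \<open>\<G>\<close> in these subcovers are collected.\<close>

lemma lindelof_le_minus_point:
  assumes inf: "infinite K" and L: "lindelof_le Y K" and \<psi>: "pseudochar_le Y K"
    and x: "x \<in> topspace Y"
    and \<G>: "\<And>G. G \<in> \<G> \<Longrightarrow> openin Y G" "topspace Y - {x} \<subseteq> \<Union>\<G>"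
  obtains \<V> where "\<V> \<subseteq> \<G>" "|\<V>| \<le>o |K|" "topspace Y - {x} \<subseteq> \<Union>\<V>"
proof -
  obtain \<U> where \<U>: "\<And>U. U \<in> \<U> \<Longrightarrow> openin Y U" "|\<U>| \<le>o |K|" "topspace Y \<inter> \<Inter>\<U> = {x}"
    using \<psi> x unfolding pseudochar_le_def by metis
  have "\<exists>\<V> \<subseteq> insert U \<G>. |\<V>| \<le>o |K| \<and> topspace Y \<subseteq> \<Union>\<V>" if "U \<in> \<U>" for U
  proof -
    have "x \<in> U"
      using \<U>(3) that by blast
    then have "topspace Y \<subseteq> \<Union>(insert U \<G>)"
      using \<G>(2) by blast
    then show ?thesis
      using L \<U>(1)[OF that] \<G>(1) unfolding lindelof_le_def by simp
  qed
  then obtain \<V> where \<V>: "\<And>U. U \<in> \<U> \<Longrightarrow> \<V> U \<subseteq> insert U \<G>"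
      "\<And>U. U \<in> \<U> \<Longrightarrow> |\<V> U| \<le>o |K|" "\<And>U. U \<in> \<U> \<Longrightarrow> topspace Y \<subseteq> \<Union>(\<V> U)"
    by metis
  show thesis
  proof
    show "(\<Union>U\<in>\<U>. \<V> U) \<inter> \<G> \<subseteq> \<G>"
      by blast
    have "|\<Union>U\<in>\<U>. \<V> U| \<le>o |K|"
      using inf \<U>(2) \<V>(2) by (intro card_of_UNION_ordLeq_infinite) auto
    then show "|(\<Union>U\<in>\<U>. \<V> U) \<inter> \<G>| \<le>o |K|"
      using card_of_mono1[of "(\<Union>U\<in>\<U>. \<V> U) \<inter> \<G>"] ordLeq_transitive by blast
    show "topspace Y - {x} \<subseteq> \<Union>((\<Union>U\<in>\<U>. \<V> U) \<inter> \<G>)"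
    proof
      fix z assume z: "z \<in> topspace Y - {x}"
      then obtain U where U: "U \<in> \<U>" "z \<notin> U"
        using \<U>(3) by blast
      then obtain V where "V \<in> \<V> U" "z \<in> V"
        using \<V>(3) z by blast
      then show "z \<in> \<Union>((\<Union>U\<in>\<U>. \<V> U) \<inter> \<G>)"
        using U \<V>(1) by blast
    qed
  qed
qed

lemma subtopology_lindelof_le_minus_point:
  assumes "infinite K" "lindelof_le (subtopology X Y) K" "pseudochar_le (subtopology X Y) K"
    and "Y \<subseteq> topspace X" "x \<in> Y"
    and "\<And>G. G \<in> \<G> \<Longrightarrow> openin X G" "Y - {x} \<subseteq> \<Union>\<G>"
  obtains \<V> where "\<V> \<subseteq> \<G>" "|\<V>| \<le>o |K|" "Y - {x} \<subseteq> \<Union>\<V>"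
proof -
  have Y: "topspace (subtopology X Y) = Y"
    using assms(4) by auto
  have "topspace (subtopology X Y) - {x} \<subseteq> \<Union>((\<inter>) Y ` \<G>)"
    using assms(7) Y by blast
  moreover have "openin (subtopology X Y) G" if "G \<in> (\<inter>) Y ` \<G>" for G
    using that assms(6) by (auto simp: openin_subtopology_Int2)
  ultimately obtain \<W> where \<W>: "\<W> \<subseteq> (\<inter>) Y ` \<G>" "|\<W>| \<le>o |K|" "Y - {x} \<subseteq> \<Union>\<W>"
    using lindelof_le_minus_point[OF assms(1-3), of x "(\<inter>) Y ` \<G>"] Y assms(5) by metis
  \<comment> \<open>One preimage is chosen for each trace, so that passing back to
    \<open>\<G>\<close> does not enlarge the family.\<close>
  then obtain \<V> where \<V>: "\<V> \<subseteq> \<G>" "inj_on ((\<inter>) Y) \<V>" "\<W> = (\<inter>) Y ` \<V>"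
    using subset_image_inj by metis
  then have "|\<V>| \<le>o |\<W>|"
    using card_of_ordLeq by blast
  then have "|\<V>| \<le>o |K|"
    using \<W>(2) by (rule ordLeq_transitive)
  moreover have "Y - {x} \<subseteq> \<Union>\<V>"
    using \<W>(3) \<V>(3) by blast
  ultimately show thesis
    using that \<V>(1) by blast
qed

section \<open>Spaces in which every small set lies in a piece\<close>

text \<open>Directedness takes the place of the chain order so that two instances fit: the given
  chain, and a single piece regarded as its own space. The pieces cover the space because singletons
  are small.\<close>

locale directed_cover =
  fixes X :: "'a topology" and K :: "'k set" and \<Y> :: "'a set set"
  assumes Hausdorff: "Hausdorff_space X"
    and inf: "infinite K"
    and sub: "Y \<in> \<Y> \<Longrightarrow> Y \<subseteq> topspace X"
    and directed: "S \<subseteq> topspace X \<Longrightarrow> |S| \<le>o |Pow K| \<Longrightarrow> \<exists>Y\<in>\<Y>. S \<subseteq> Y"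
    and tight: "Y \<in> \<Y> \<Longrightarrow> tightness_le (subtopology X Y) K"
    and pseudochar: "Y \<in> \<Y> \<Longrightarrow> pseudochar_le (subtopology X Y) K"
    and lindelof: "Y \<in> \<Y> \<Longrightarrow> lindelof_le (subtopology X Y) K"
begin

lemma infP: "infinite (Pow K)"
  using inf by simp

lemma directed_insert:
  assumes "S \<subseteq> topspace X" "|S| \<le>o |Pow K|" "x \<in> topspace X"
  obtains Y where "Y \<in> \<Y>" "S \<subseteq> Y" "x \<in> Y"
proof -
  have "|{x} \<union> S| \<le>o |Pow K|"
    by (intro card_of_Un_ordLeq_Pow[OF inf _ assms(2)] finite_ordLeq_infinite[OF _ infP]) simp
  then show thesis
    using directed[of "{x} \<union> S"] assms that by auto
qed

section \<open>Closures of small sets\<close>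

lemma separating_open:
  assumes "x \<in> topspace X" "y \<in> topspace X" "x \<noteq> y"
  obtains G where "openin X G" "y \<in> G" "x \<notin> X closure_of G"
proof -
  obtain U V where "openin X U" "openin X V" "x \<in> U" "y \<in> V" "disjnt U V"
    using Hausdorff assms unfolding Hausdorff_space_def by metis
  then show thesis
    using that[of V] by (auto simp: in_closure_of disjnt_iff)
qed

text \<open>Each point of \<open>Y\<close> other than \<open>x\<close> has an open neighbourhood
  whose closure misses \<open>x\<close>, and at most \<kappa> of these cover \<open>Y - {x}\<close>.
  The complements of their closures form \<open>\<V>\<close>. They are open in \<open>X\<close>, not
  merely in \<open>Y\<close>, because they will be intersected with a set that need not lie in
  \<open>Y\<close>.\<close>

lemma closed_pseudocharacter:
  assumes Y: "Y \<in> \<Y>" and x: "x \<in> Y"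
  obtains \<V> where "|\<V>| \<le>o |K|" "\<And>V. V \<in> \<V> \<Longrightarrow> openin X V \<and> x \<in> V"
    "\<And>z. z \<in> Y \<Longrightarrow> z \<noteq> x \<Longrightarrow> \<exists>V\<in>\<V>. z \<notin> X closure_of V"
proof -
  define \<G> where "\<G> = {G. openin X G \<and> x \<notin> X closure_of G}"
  have "Y - {x} \<subseteq> \<Union>\<G>"
    using separating_open x sub[OF Y] unfolding \<G>_def by blast
  then obtain \<H> where \<H>: "\<H> \<subseteq> \<G>" "|\<H>| \<le>o |K|" "Y - {x} \<subseteq> \<Union>\<H>"
    using subtopology_lindelof_le_minus_point[OF inf lindelof[OF Y] pseudochar[OF Y] sub[OF Y] x, of \<G>]
    unfolding \<G>_def by blast
  show thesis
  proof
    show "|(\<lambda>G. topspace X - X closure_of G) ` \<H>| \<le>o |K|"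
      using \<H>(2) card_of_image ordLeq_transitive by blast
    show "openin X V \<and> x \<in> V" if "V \<in> (\<lambda>G. topspace X - X closure_of G) ` \<H>" for V
      using that \<H>(1) x sub[OF Y] unfolding \<G>_def by auto
    show "\<exists>V\<in>(\<lambda>G. topspace X - X closure_of G) ` \<H>. z \<notin> X closure_of V" if z: "z \<in> Y" "z \<noteq> x" for z
    proof -
      obtain G where G: "G \<in> \<H>" "z \<in> G"
        using \<H>(3) z by blast
      then have "openin X G"
        using \<H>(1) unfolding \<G>_def by blast
      moreover have "G \<inter> (topspace X - X closure_of G) = {}"
        using closure_of_subset[of G X] openin_subset[OF \<open>openin X G\<close>] by blast
      ultimately have "z \<notin> X closure_of (topspace X - X closure_of G)"
        using G(2) by (auto simp: in_closure_of)
      then show ?thesis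
        using G(1) by blast
    qed
  qed
qed

text \<open>A point of the closure of a small set \<open>A\<close> is determined by a small family of subsets of
  \<open>A\<close>.  Each member of \<open>\<Y>\<close> yields such a family for its own points; if none of these families
  worked in all of \<open>X\<close>, at most \<open>2\<^sup>\<kappa>\<close> witnesses of failure would lie in one member of \<open>\<Y>\<close>.\<close>

lemma closure_point_code:
  assumes A: "A \<subseteq> topspace X" "|A| \<le>o |K|" and x: "x \<in> X closure_of A"
  shows "\<exists>W. W \<subseteq> Pow A \<and> |W| \<le>o |K| \<and> topspace X \<inter> (\<Inter>w\<in>W. X closure_of w) = {x}"
proof (rule ccontr)
  assume neg: "\<not> ?thesis"
  define \<W> where "\<W> = {W. W \<subseteq> Pow A \<and> |W| \<le>o |K|}"
  have xX: "x \<in> topspace X"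
    using x by (simp add: in_closure_of)
  \<comment> \<open>When \<open>x\<close> is outside the intersection, any point of the space will
    do; this makes the choice of \<open>z\<close> total on \<open>\<W>\<close>.\<close>
  have "\<exists>z. z \<in> topspace X \<and> (x \<in> (\<Inter>w\<in>W. X closure_of w) \<longrightarrow> z \<noteq> x \<and> z \<in> (\<Inter>w\<in>W. X closure_of w))"
    if "W \<in> \<W>" for W
  proof -
    have "topspace X \<inter> (\<Inter>w\<in>W. X closure_of w) \<noteq> {x}"
      using neg that unfolding \<W>_def by simp
    then show ?thesis
      using xX by blast
  qed
  then obtain z where z: "\<And>W. W \<in> \<W> \<Longrightarrow> z W \<in> topspace X"
    "\<And>W. W \<in> \<W> \<Longrightarrow> x \<in> (\<Inter>w\<in>W. X closure_of w) \<Longrightarrow> z W \<noteq> x \<and> z W \<in> (\<Inter>w\<in>W. X closure_of w)"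
    by metis
  have "|\<W>| \<le>o |Pow K|"
    unfolding \<W>_def by (intro card_of_small_subsets[OF inf] card_of_Pow_mono A(2))
  then have "|z ` \<W>| \<le>o |Pow K|"
    using card_of_image ordLeq_transitive by blast
  then obtain Y where Y: "Y \<in> \<Y>" "z ` \<W> \<subseteq> Y" "x \<in> Y"
    using directed_insert[of "z ` \<W>" x] z(1) xX by blast
  obtain \<V> where \<V>: "|\<V>| \<le>o |K|" "\<And>V. V \<in> \<V> \<Longrightarrow> openin X V \<and> x \<in> V"
    "\<And>z. z \<in> Y \<Longrightarrow> z \<noteq> x \<Longrightarrow> \<exists>V\<in>\<V>. z \<notin> X closure_of V"
    using closed_pseudocharacter[OF Y(1,3)] by metis
  \<comment> \<open>The traces on \<open>A\<close> of neighbourhoods isolating \<open>x\<close> in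
    \<open>Y\<close> form a code that works for all points of \<open>Y\<close>. Its own witness of
    failure \<open>z W\<close> was placed in \<open>Y\<close>.\<close>
  define W where "W = (\<inter>) A ` \<V>"
  have W: "W \<in> \<W>"
    unfolding W_def \<W>_def using \<V>(1) card_of_image ordLeq_transitive by blast
  have "x \<in> X closure_of (A \<inter> V)" if "V \<in> \<V>" for V
    using x \<V>(2)[OF that] openin_Int_closure_of_subset[of X V A] by (auto simp: Int_commute)
  then have "x \<in> (\<Inter>w\<in>W. X closure_of w)"
    unfolding W_def by blast
  then have "z W \<noteq> x" "z W \<in> (\<Inter>w\<in>W. X closure_of w)" "z W \<in> Y"
    using z(2)[OF W] Y(2) W by auto
  moreover obtain V where "V \<in> \<V>" "z W \<notin> X closure_of V"
    using \<V>(3) calculation by blast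
  moreover have "X closure_of (A \<inter> V) \<subseteq> X closure_of V"
    by (simp add: closure_of_mono)
  ultimately show False
    unfolding W_def by blast
qed

text \<open>A code determines its point, and there are at most (2^\<kappa>)^\<kappa> = 2^\<kappa>
  codes.\<close>

lemma card_of_closure_of:
  assumes A: "A \<subseteq> topspace X" "|A| \<le>o |K|"
  shows "|X closure_of A| \<le>o |Pow K|"
proof -
  obtain W where W: "\<And>x. x \<in> X closure_of A \<Longrightarrow>
      W x \<subseteq> Pow A \<and> |W x| \<le>o |K| \<and> topspace X \<inter> (\<Inter>w\<in>W x. X closure_of w) = {x}"
    using closure_point_code[OF A] by metis
  have "inj_on W (X closure_of A)"
    using W by (metis inj_onI the_elem_eq)
  moreover have "W ` (X closure_of A) \<subseteq> {W. W \<subseteq> Pow A \<and> |W| \<le>o |K|}"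
    using W by blast
  ultimately have "|X closure_of A| \<le>o |{W. W \<subseteq> Pow A \<and> |W| \<le>o |K|}|"
    using card_of_ordLeq by blast
  then show ?thesis
    using card_of_small_subsets[OF inf card_of_Pow_mono[OF A(2)]] ordLeq_transitive by blast
qed

section \<open>Closed sets of size at most 2^\<kappa>\<close>

lemma closedin_if_small_closures:
  assumes H: "H \<subseteq> topspace X" "|H| \<le>o |Pow K|"
    and cl: "\<And>A. A \<subseteq> H \<Longrightarrow> |A| \<le>o |K| \<Longrightarrow> X closure_of A \<subseteq> H"
  shows "closedin X H"
proof -
  have "y \<in> H" if y: "y \<in> X closure_of H" for y
  proof -
    have "y \<in> topspace X"
      using y by (simp add: in_closure_of)
    then obtain Y where Y: "Y \<in> \<Y>" "H \<subseteq> Y" "y \<in> Y"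
      using directed_insert[OF H] by blast
    have "y \<in> subtopology X Y closure_of H"
      using y Y by (simp add: closure_of_subtopology Int_absorb1)
    moreover have "H \<subseteq> topspace (subtopology X Y)"
      using H(1) Y(2) by auto
    ultimately obtain B where B: "B \<subseteq> H" "|B| \<le>o |K|" "y \<in> subtopology X Y closure_of B"
      using tight[OF Y(1)] unfolding tightness_le_def by blast
    then have "y \<in> X closure_of B"
      using closure_of_subtopology_subset by fastforce
    then show ?thesis
      using cl B by blast
  qed
  then show ?thesis
    using H(1) closure_of_subset[OF H(1)] closure_of_eq by blast
qed

lemma closed_lindelof_minus_point:
  assumes H: "closedin X H" "|H| \<le>o |Pow K|" and q: "q \<in> topspace X"
    and \<G>: "\<And>G. G \<in> \<G> \<Longrightarrow> openin X G" "H - {q} \<subseteq> \<Union>\<G>"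
  obtains \<V> where "\<V> \<subseteq> \<G>" "|\<V>| \<le>o |K|" "H - {q} \<subseteq> \<Union>\<V>"
proof -
  have HX: "H \<subseteq> topspace X"
    using H(1) by (rule closedin_subset)
  obtain Y where Y: "Y \<in> \<Y>" "H \<subseteq> Y" "q \<in> Y"
    using directed_insert[OF HX H(2) q] by blast
  have "Y - {q} \<subseteq> \<Union>(insert (topspace X - H) \<G>)"
    using \<G>(2) sub[OF Y(1)] by blast
  moreover have "openin X G" if "G \<in> insert (topspace X - H) \<G>" for G
    using that \<G>(1) H(1) by blast
  ultimately obtain \<V> where \<V>: "\<V> \<subseteq> insert (topspace X - H) \<G>" "|\<V>| \<le>o |K|" "Y - {q} \<subseteq> \<Union>\<V>"
    using subtopology_lindelof_le_minus_point
      [OF inf lindelof[OF Y(1)] pseudochar[OF Y(1)] sub[OF Y(1)] Y(3), of "insert (topspace X - H) \<G>"]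
    by metis
  show thesis
  proof
    show "\<V> \<inter> \<G> \<subseteq> \<G>"
      by blast
    show "|\<V> \<inter> \<G>| \<le>o |K|"
      using \<V>(2) card_of_mono1[of "\<V> \<inter> \<G>" \<V>] ordLeq_transitive by blast
    show "H - {q} \<subseteq> \<Union>(\<V> \<inter> \<G>)"
      using \<V>(1,3) Y(2) by blast
  qed
qed

text \<open>Closing off under \<open>X closure_of A\<close> together with \<open>F A\<close> forces
  the resulting set to be closed.\<close>

lemma closing_off_closed:
  assumes F: "\<And>A. A \<subseteq> topspace X \<Longrightarrow> |A| \<le>o |K| \<Longrightarrow> F A \<subseteq> topspace X \<and> |F A| \<le>o |Pow K|"
  obtains H where "closedin X H" "|H| \<le>o |Pow K|"
    "\<And>A. A \<subseteq> H \<Longrightarrow> |A| \<le>o |K| \<Longrightarrow> F A \<subseteq> H"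
proof -
  have *: "X closure_of A \<union> F A \<subseteq> topspace X \<and> |X closure_of A \<union> F A| \<le>o |Pow K|"
    if "A \<subseteq> topspace X" "|A| \<le>o |K|" for A
    using F[OF that] card_of_closure_of[OF that] closure_of_subset_topspace
    by (simp add: card_of_Un_ordLeq_Pow[OF inf])
  show thesis
  proof (rule closing_off[OF inf * empty_subsetI card_of_empty])
    fix H assume H: "H \<subseteq> topspace X" "|H| \<le>o |Pow K|"
      "\<And>A. A \<subseteq> H \<Longrightarrow> |A| \<le>o |K| \<Longrightarrow> X closure_of A \<union> F A \<subseteq> H"
    then have "closedin X H"
      by (intro closedin_if_small_closures) auto
    then show thesis
      using that[of H] H by simp
  qed
qed

section \<open>Pseudocharacter and cardinality of the whole space\<close>

text \<open>At most \<kappa> of the sets \<open>G a\<close> cover everything except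
  \<open>q\<close>, and the complements of their closures meet in \<open>q\<close> alone. To find
  them, \<open>H\<close> is closed off under picking a point that a small subfamily leaves
  uncovered.\<close>

lemma pseudocharacter:
  assumes q: "q \<in> topspace X"
  shows "\<exists>\<V>. (\<forall>V\<in>\<V>. openin X V) \<and> |\<V>| \<le>o |K| \<and> topspace X \<inter> \<Inter>\<V> = {q}"
proof -
  have "\<exists>G. openin X G \<and> y \<in> G \<and> q \<notin> X closure_of G" if "y \<in> topspace X - {q}" for y
    using separating_open[OF q, of y] that by blast
  then obtain G where G: "\<And>y. y \<in> topspace X - {q} \<Longrightarrow> openin X (G y) \<and> y \<in> G y \<and> q \<notin> X closure_of (G y)"
    by metis
  define D where "D A = topspace X - {q} - (\<Union>a\<in>A. G a)" for A
  define F where "F A = (if D A = {} then {} else {SOME z. z \<in> D A})" for A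
  have F_sub: "F A \<subseteq> D A" for A
    unfolding F_def by (auto intro: someI_ex)
  have "finite (F A)" for A
    unfolding F_def by simp
  then have "|F A| \<le>o |Pow K|" for A
    using infP finite_ordLeq_infinite by blast
  then obtain H where H: "closedin X H" "|H| \<le>o |Pow K|"
    "\<And>A. A \<subseteq> H \<Longrightarrow> |A| \<le>o |K| \<Longrightarrow> F A \<subseteq> H"
    using closing_off_closed[of F] F_sub D_def by (metis Diff_subset subset_trans)
  have HX: "H \<subseteq> topspace X"
    using H(1) by (rule closedin_subset)
  have "H - {q} \<subseteq> \<Union>(G ` (H - {q}))"
    using G HX by blast
  moreover have "openin X U" if "U \<in> G ` (H - {q})" for U
    using that G HX by blast
  ultimately obtain \<V> where \<V>: "\<V> \<subseteq> G ` (H - {q})" "|\<V>| \<le>o |K|" "H - {q} \<subseteq> \<Union>\<V>"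
    using closed_lindelof_minus_point[OF H(1,2) q] by metis
  then obtain A where A: "A \<subseteq> H - {q}" "inj_on G A" "\<V> = G ` A"
    using subset_image_inj by metis
  have AK: "|A| \<le>o |K|"
    using A \<V>(2) card_of_ordLeq ordLeq_transitive by (metis order_refl)
  then have "F A \<subseteq> H"
    using H(3) A(1) by blast
  moreover have "D A \<inter> H = {}"
    using \<V>(3) A(3) unfolding D_def by blast
  \<comment> \<open>Otherwise the point picked by \<open>F A\<close> would lie both in
    \<open>H\<close> and in \<open>D A\<close>.\<close>
  ultimately have "D A = {}"
    using F_sub[of A] unfolding F_def by (auto split: if_splits)
  show ?thesis
  proof (intro exI conjI ballI)
    show "openin X V" if "V \<in> (\<lambda>a. topspace X - X closure_of (G a)) ` A" for V
      using that by auto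
    show "|(\<lambda>a. topspace X - X closure_of (G a)) ` A| \<le>o |K|"
      using AK card_of_image ordLeq_transitive by blast
    show "topspace X \<inter> \<Inter>((\<lambda>a. topspace X - X closure_of (G a)) ` A) = {q}"
    proof -
      have "q \<notin> X closure_of (G a)" if "a \<in> A" for a
        using G A(1) HX that by blast
      moreover have "\<exists>a\<in>A. z \<in> X closure_of (G a)" if z: "z \<in> topspace X" "z \<noteq> q" for z
      proof -
        obtain a where a: "a \<in> A" "z \<in> G a"
          using \<open>D A = {}\<close> z unfolding D_def by blast
        then have "G a \<subseteq> topspace X"
          using G A(1) HX openin_subset by blast
        then show ?thesis
          using a closure_of_subset by blast
      qed
      ultimately show ?thesis
        using q by blast
    qed
  qed
qed

text \<open>If \<open>q\<close> lay outside \<open>H\<close>, at most \<kappa> sets from the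
  families \<open>B p\<close> with \<open>p\<close> in \<open>H\<close> would cover \<open>H\<close>
  and miss \<open>q\<close>. The point chosen outside their union would then belong to
  \<open>H\<close>, a contradiction.\<close>

lemma card_of_topspace: "|topspace X| \<le>o |Pow K|"
proof -
  obtain B where B: "\<And>p. p \<in> topspace X \<Longrightarrow>
      (\<forall>V\<in>B p. openin X V) \<and> |B p| \<le>o |K| \<and> topspace X \<inter> \<Inter>(B p) = {p}"
    using pseudocharacter by metis
  define w where "w \<V> = (SOME z. z \<in> topspace X - \<Union>\<V>)" for \<V>
  have w: "w \<V> \<in> topspace X - \<Union>\<V>" if "\<not> topspace X \<subseteq> \<Union>\<V>" for \<V>
    unfolding w_def by (rule someI_ex) (use that in blast)
  define F where "F A = w ` {\<V>. \<V> \<subseteq> (\<Union>p\<in>A. B p) \<and> \<not> topspace X \<subseteq> \<Union>\<V>}" for A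
  have F: "F A \<subseteq> topspace X \<and> |F A| \<le>o |Pow K|" if A: "A \<subseteq> topspace X" "|A| \<le>o |K|" for A
  proof
    show "F A \<subseteq> topspace X"
      using w unfolding F_def by blast
    have "|\<Union>p\<in>A. B p| \<le>o |K|"
      using A B by (intro card_of_UNION_ordLeq_infinite[OF inf]) auto
    then have "|Pow (\<Union>p\<in>A. B p)| \<le>o |Pow K|"
      by (rule card_of_Pow_mono)
    moreover have "F A \<subseteq> w ` Pow (\<Union>p\<in>A. B p)"
      unfolding F_def by blast
    ultimately show "|F A| \<le>o |Pow K|"
      using surj_imp_ordLeq ordLeq_transitive by blast
  qed
  obtain H where H: "closedin X H" "|H| \<le>o |Pow K|"
    "\<And>A. A \<subseteq> H \<Longrightarrow> |A| \<le>o |K| \<Longrightarrow> F A \<subseteq> H"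
    using closing_off_closed[of F] F by metis
  have HX: "H \<subseteq> topspace X"
    using H(1) by (rule closedin_subset)
  have "q \<in> H" if q: "q \<in> topspace X" for q
  proof (rule ccontr)
    assume "q \<notin> H"
    have "\<exists>V\<in>B p. q \<notin> V" if p: "p \<in> H" for p
    proof -
      have "topspace X \<inter> \<Inter>(B p) = {p}" "p \<noteq> q"
        using B p HX \<open>q \<notin> H\<close> by auto
      then have "q \<notin> \<Inter>(B p)"
        using q by (metis IntI singletonD)
      then show ?thesis
        by simp
    qed
    then obtain V where V: "\<And>p. p \<in> H \<Longrightarrow> V p \<in> B p \<and> q \<notin> V p"
      by metis
    have VB: "openin X (V p) \<and> p \<in> V p" if p: "p \<in> H" for p
    proof -
      have "topspace X \<inter> \<Inter>(B p) = {p}" "openin X (V p)"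
        using B p V[OF p] HX by auto
      then show ?thesis
        using V[OF p] by (metis IntD2 InterD singletonI)
    qed
    then have "H - {q} \<subseteq> \<Union>(V ` H)" "\<And>U. U \<in> V ` H \<Longrightarrow> openin X U"
      by auto
    then obtain \<V> where \<V>: "\<V> \<subseteq> V ` H" "|\<V>| \<le>o |K|" "H - {q} \<subseteq> \<Union>\<V>"
      using closed_lindelof_minus_point[OF H(1,2) q] by metis
    then obtain A where A: "A \<subseteq> H" "inj_on V A" "\<V> = V ` A"
      using subset_image_inj by metis
    have AK: "|A| \<le>o |K|"
      using A \<V>(2) card_of_ordLeq ordLeq_transitive by (metis order_refl)
    have cov: "\<not> topspace X \<subseteq> \<Union>\<V>"
      using q A V by blast
    moreover have "\<V> \<subseteq> (\<Union>p\<in>A. B p)"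
      using A V by blast
    ultimately have "w \<V> \<in> F A"
      unfolding F_def by blast
    then have "w \<V> \<in> H"
      using H(3)[OF A(1) AK] by blast
    then show False
      using w[OF cov] \<V>(3) \<open>q \<notin> H\<close> by blast
  qed
  then show ?thesis
    using ordLeq_transitive[OF card_of_mono1 H(2)] by blast
qed

end

section \<open>From the chain to directed covers\<close>

theorem theorem1p1:
  fixes X :: "'a topology" and K :: "'k set" and lam :: "'i::wellorder"
    and Xs :: "'i \<Rightarrow> 'a set"
  assumes "Hausdorff_space X"
    and "infinite K"
    and "topspace X = (\<Union>\<alpha>\<in>{..<lam}. Xs \<alpha>)"
    and "\<And>\<alpha> \<beta>. \<alpha> < \<beta> \<Longrightarrow> \<beta> < lam \<Longrightarrow> Xs \<alpha> \<subseteq> Xs \<beta>"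
    and "\<And>\<alpha>. \<alpha> < lam \<Longrightarrow> tightness_le (subtopology X (Xs \<alpha>)) K"
    and "\<And>\<alpha>. \<alpha> < lam \<Longrightarrow> pseudochar_le (subtopology X (Xs \<alpha>)) K"
    and "\<And>\<alpha>. \<alpha> < lam \<Longrightarrow> lindelof_le (subtopology X (Xs \<alpha>)) K"
  shows "ordLeq3 (card_of (topspace X)) (card_of (Pow K))"
proof (cases "\<forall>S \<subseteq> topspace X. |S| \<le>o |Pow K| \<longrightarrow> (\<exists>\<alpha><lam. S \<subseteq> Xs \<alpha>)")
  case True
  interpret directed_cover X K "Xs ` {..<lam}"
  proof
    show "\<exists>Y\<in>Xs ` {..<lam}. S \<subseteq> Y" if "S \<subseteq> topspace X" "|S| \<le>o |Pow K|" for S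
      using True[rule_format, OF that] by blast
    show "Y \<subseteq> topspace X" if "Y \<in> Xs ` {..<lam}" for Y
      using that assms(3) by blast
  qed (use assms(1,2,5-7) in auto)
  show ?thesis
    by (rule card_of_topspace)
next
  case False
  then obtain S where S: "S \<subseteq> topspace X" "|S| \<le>o |Pow K|" "\<And>\<alpha>. \<alpha> < lam \<Longrightarrow> \<not> S \<subseteq> Xs \<alpha>"
    by blast
  have small: "|Xs \<alpha>| \<le>o |Pow K|" if \<alpha>: "\<alpha> < lam" for \<alpha>
  proof -
    have top: "topspace (subtopology X (Xs \<alpha>)) = Xs \<alpha>"
      using assms(3) \<alpha> by auto
    interpret directed_cover "subtopology X (Xs \<alpha>)" K "{Xs \<alpha>}"
      proof
      show "Hausdorff_space (subtopology X (Xs \<alpha>))"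
        using assms(1) by (rule Hausdorff_space_subtopology)
    qed (use \<alpha> assms(2,5-7) top in \<open>simp_all add: subtopology_subtopology del: topspace_subtopology\<close>)
    show ?thesis
      using card_of_topspace top by simp
  qed
  have "\<exists>\<beta><lam. s \<in> Xs \<beta>" if "s \<in> S" for s
    using S(1) assms(3) that by blast
  then obtain \<beta> where \<beta>: "\<And>s. s \<in> S \<Longrightarrow> \<beta> s < lam \<and> s \<in> Xs (\<beta> s)"
    by metis
  \<comment> \<open>The indices \<open>\<beta> s\<close> are cofinal below \<open>lam\<close>: each
    \<open>Xs \<alpha>\<close> omits some \<open>s\<close> in \<open>S\<close>, and a piece
    containing that \<open>s\<close> must come later in the chain.\<close>
  have "topspace X \<subseteq> (\<Union>s\<in>S. Xs (\<beta> s))"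
  proof
    fix x assume "x \<in> topspace X"
    then obtain \<alpha> where \<alpha>: "\<alpha> < lam" "x \<in> Xs \<alpha>"
      using assms(3) by auto
    then obtain s where s: "s \<in> S" "s \<notin> Xs \<alpha>"
      using S(3) by blast
    then have "\<alpha> < \<beta> s"
      using \<beta>[OF s(1)] assms(4)[of "\<beta> s" \<alpha>] \<alpha>(1) by (metis linorder_less_linear subsetD)
    then have "x \<in> Xs (\<beta> s)"
      using \<beta>[OF s(1)] assms(4) \<alpha>(2) by blast
    then show "x \<in> (\<Union>s\<in>S. Xs (\<beta> s))"
      using s(1) by blast
  qed
  moreover have "|\<Union>s\<in>S. Xs (\<beta> s)| \<le>o |Pow K|"
    using small \<beta> S(2) assms(2)
    by (intro card_of_UNION_ordLeq_infinite) (auto)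
  ultimately show ?thesis
    by (rule ordLeq_transitive[OF card_of_mono1])
qed

end
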